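(* Let $\alpha$ and $\beta$ be positive constants, and let $\mathcal{F}$ be a family of finite quasiprimitive permutation groups $G$ on sets $\Omega$ satisfying (a) $\mu(G)\le(1-\alpha)|\Omega|$, and (b) $|G_\omega|\le\beta$ for every $\omega\in\Omega$. Then $\mathcal{F}$ is finite (up to permutational isomorphism).
   Context: A permutation group $G$ on $\Omega$ is quasiprimitive if every nontrivial normal subgroup of $G$ is transitive on $\Omega$. The minimal degree is $\mu(G)=\min_{g\in G\setminus\{1\}}|\mathrm{supp}(g)|$, where $\mathrm{supp}(g)$ is the set of points moved by $g$. $G_\omega$ is the point stabilizer. *)

theory Defs
  imports Complex_Main "HOL-Algebra.Group_Action"
begin

text \<open>
  A permutation group on \<open>\<Omega>\<close> is a subgroup \<open>G\<close> of \<^term>\<open>BijGroup \<Omega>\<close>. Its elements are extensional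
  functions, so the identity permutation is \<open>\<one>\<^bsub>BijGroup \<Omega>\<^esub> = (\<lambda>x\<in>\<Omega>. x)\<close>.
\<close>

definition perm_group :: "'a set \<Rightarrow> ('a \<Rightarrow> 'a) set \<Rightarrow> ('a \<Rightarrow> 'a) monoid" where
  "perm_group \<Omega> G = (BijGroup \<Omega>)\<lparr>carrier := G\<rparr>"

definition quasiprimitive :: "'a set \<Rightarrow> ('a \<Rightarrow> 'a) set \<Rightarrow> bool" where
  "quasiprimitive \<Omega> G \<longleftrightarrow>
     subgroup G (BijGroup \<Omega>) \<and>
     (\<forall>N. N \<lhd> perm_group \<Omega> G \<and> N \<noteq> {\<one>\<^bsub>BijGroup \<Omega>\<^esub>} \<longrightarrow>
          transitive_action (perm_group \<Omega> N) \<Omega> (\<lambda>g. g))"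

definition supp :: "'a set \<Rightarrow> ('a \<Rightarrow> 'a) \<Rightarrow> 'a set" where
  "supp \<Omega> g = {x \<in> \<Omega>. g x \<noteq> x}"

text \<open>Only meaningful for finite \<open>\<Omega>\<close> and nontrivial \<open>G\<close>: otherwise the minimum is over an empty
  set (or over junk cardinalities).\<close>

definition min_degree :: "'a set \<Rightarrow> ('a \<Rightarrow> 'a) set \<Rightarrow> nat" where
  "min_degree \<Omega> G = Min ((\<lambda>g. card (supp \<Omega> g)) ` (G - {\<one>\<^bsub>BijGroup \<Omega>\<^esub>}))"

definition perm_isomorphic ::
    "'a set \<times> ('a \<Rightarrow> 'a) set \<Rightarrow> 'b set \<times> ('b \<Rightarrow> 'b) set \<Rightarrow> bool" where
  "perm_isomorphic = (\<lambda>(\<Omega>, G) (\<Omega>', G').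
     \<exists>f \<psi>. bij_betw f \<Omega> \<Omega>' \<and>
           \<psi> \<in> iso (perm_group \<Omega> G) (perm_group \<Omega>' G') \<and>
           (\<forall>g\<in>G. \<forall>x\<in>\<Omega>. f (g x) = \<psi> g (f x)))"

end

(*
  Let g be a nontrivial element fixing at least \<alpha>|\<Omega>| points and let K be its conjugacy class.
  All members of K fix equally many points, so counting the pairs (k, x) with k x = x in two ways
  gives |K| \<alpha> |\<Omega>| \<le> \<beta> |\<Omega>|, that is, |K| \<le> \<beta>/\<alpha>. The centralizer C of K is normal. If it were
  nontrivial, it would be transitive; but g commutes with C and fixes a point, so g would be
  trivial. Hence C = 1, G acts faithfully on K by conjugation, and |\<Omega>| \<le> |G| is bounded in terms
  of \<beta>/\<alpha> alone.
*)
theory Submission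
  imports Defs
begin

section \<open>Conjugacy classes and their centralizers\<close>

definition conj_class :: "('a, 'b) monoid_scheme \<Rightarrow> 'a \<Rightarrow> 'a set" where
  "conj_class G g = (\<lambda>x. x \<otimes>\<^bsub>G\<^esub> g \<otimes>\<^bsub>G\<^esub> inv\<^bsub>G\<^esub> x) ` carrier G"

definition set_centralizer :: "('a, 'b) monoid_scheme \<Rightarrow> 'a set \<Rightarrow> 'a set" where
  "set_centralizer G K = {c \<in> carrier G. \<forall>k\<in>K. c \<otimes>\<^bsub>G\<^esub> k = k \<otimes>\<^bsub>G\<^esub> c}"

context group
begin

lemma conj_class_subset: "g \<in> carrier G \<Longrightarrow> conj_class G g \<subseteq> carrier G"
  by (auto simp: conj_class_def)

lemma conj_class_self: "g \<in> carrier G \<Longrightarrow> g \<in> conj_class G g"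
  unfolding conj_class_def by (rule image_eqI[where x = \<one>]) auto

lemma conj_class_closed:
  assumes "g \<in> carrier G" "k \<in> conj_class G g" "x \<in> carrier G"
  shows "x \<otimes> k \<otimes> inv x \<in> conj_class G g"
proof -
  obtain y where y: "y \<in> carrier G" "k = y \<otimes> g \<otimes> inv y"
    using assms(2) by (auto simp: conj_class_def)
  have "x \<otimes> k \<otimes> inv x = (x \<otimes> y) \<otimes> g \<otimes> inv (x \<otimes> y)"
    using y assms by (simp add: m_assoc inv_mult_group)
  then show ?thesis
    using y assms by (auto simp: conj_class_def)
qed

lemma commute_inv:
  assumes "c \<in> carrier G" "k \<in> carrier G" "c \<otimes> k = k \<otimes> c"
  shows "inv c \<otimes> k = k \<otimes> inv c"
proof -
  have "inv c \<otimes> k = inv c \<otimes> (k \<otimes> c) \<otimes> inv c"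
    using assms(1,2) by (simp add: m_assoc)
  also have "\<dots> = inv c \<otimes> (c \<otimes> k) \<otimes> inv c"
    by (simp only: assms(3))
  also have "\<dots> = k \<otimes> inv c"
    using assms(1,2) by (simp add: m_assoc[symmetric])
  finally show ?thesis .
qed

lemma conj_eq_iff:
  assumes "x \<in> carrier G" "k \<in> carrier G" "l \<in> carrier G"
  shows "x \<otimes> k \<otimes> inv x = l \<longleftrightarrow> x \<otimes> k = l \<otimes> x"
  using assms by (metis inv_solve_right' m_closed)

lemma set_centralizer_subgroup:
  assumes "K \<subseteq> carrier G"
  shows "subgroup (set_centralizer G K) G"
proof (rule subgroupI)
  show "set_centralizer G K \<subseteq> carrier G" "set_centralizer G K \<noteq> {}"
    using assms by (auto simp: set_centralizer_def intro!: exI[of _ \<one>])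
next
  fix a assume "a \<in> set_centralizer G K"
  then show "inv a \<in> set_centralizer G K"
    using assms by (auto simp: set_centralizer_def intro: commute_inv)
next
  fix a b assume ab: "a \<in> set_centralizer G K" "b \<in> set_centralizer G K"
  have "a \<otimes> b \<otimes> k = k \<otimes> (a \<otimes> b)" if "k \<in> K" for k
  proof -
    have [simp]: "a \<in> carrier G" "b \<in> carrier G" "k \<in> carrier G"
      using ab that assms by (auto simp: set_centralizer_def)
    have c: "a \<otimes> k = k \<otimes> a" "b \<otimes> k = k \<otimes> b"
      using ab that by (auto simp: set_centralizer_def)
    have "a \<otimes> b \<otimes> k = a \<otimes> k \<otimes> b"
      by (simp add: m_assoc c(2))
    then show ?thesis
      by (simp add: c(1) m_assoc)
  qed
  then show "a \<otimes> b \<in> set_centralizer G K"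
    using ab by (auto simp: set_centralizer_def)
qed

text \<open>Conjugation by \<open>inv x\<close> keeps \<open>K\<close> stable, so each k in
  \<open>K\<close> has the form x l x^-1 with l in \<open>K\<close>. Since c commutes with l,
  conjugating by x shows that x c x^-1 commutes with k.\<close>

lemma set_centralizer_normal:
  assumes "K \<subseteq> carrier G" and closed: "\<And>x k. x \<in> carrier G \<Longrightarrow> k \<in> K \<Longrightarrow> x \<otimes> k \<otimes> inv x \<in> K"
  shows "set_centralizer G K \<lhd> G"
  unfolding normal_inv_iff
proof (intro conjI ballI)
  fix x c assume x: "x \<in> carrier G" and c: "c \<in> set_centralizer G K"
  have [simp]: "c \<in> carrier G" using c by (simp add: set_centralizer_def)
  have "x \<otimes> c \<otimes> inv x \<otimes> k = k \<otimes> (x \<otimes> c \<otimes> inv x)" if "k \<in> K" for k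
  proof -
    have [simp]: "k \<in> carrier G" using that assms by auto
    define l where "l = inv x \<otimes> k \<otimes> x"
    have l: "l \<in> K" "l \<in> carrier G"
      using closed[of "inv x" k] x that assms(1) by (auto simp: l_def)
    have cl: "c \<otimes> l = l \<otimes> c"
      using c l by (auto simp: set_centralizer_def)
    have xl: "x \<otimes> l = k \<otimes> x" "inv x \<otimes> k = l \<otimes> inv x"
      using x by (simp_all add: l_def m_assoc) (simp_all add: m_assoc[symmetric])
    have "x \<otimes> c \<otimes> inv x \<otimes> k = x \<otimes> (c \<otimes> l) \<otimes> inv x"
      using x l by (simp add: m_assoc xl)
    also have "\<dots> = (x \<otimes> l) \<otimes> c \<otimes> inv x"
      using x l by (simp add: cl m_assoc)
    also have "\<dots> = k \<otimes> (x \<otimes> c \<otimes> inv x)"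
      using x by (simp add: xl m_assoc)
    finally show ?thesis .
  qed
  then show "x \<otimes> c \<otimes> inv x \<in> set_centralizer G K"
    using x by (auto simp: set_centralizer_def)
qed (rule set_centralizer_subgroup[OF assms(1)])

text \<open>The centralizer of \<open>K\<close> is the kernel of the conjugation action on
  \<open>K\<close>, so if it is trivial the group embeds into the self-maps of \<open>K\<close>.
  Counting all self-maps instead of the card K! permutations gives a cruder bound but avoids any
  bijectivity argument.\<close>

lemma card_le_of_trivial_centralizer:
  assumes K: "K \<subseteq> carrier G" "finite K"
    and closed: "\<And>x k. x \<in> carrier G \<Longrightarrow> k \<in> K \<Longrightarrow> x \<otimes> k \<otimes> inv x \<in> K"
    and triv: "set_centralizer G K = {\<one>}"
  shows "card (carrier G) \<le> card K ^ card K"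
proof -
  \<comment> \<open>Restricting to \<open>K\<close> places \<open>conj x\<close> in the finite set
    of extensional maps from \<open>K\<close> to \<open>K\<close>.\<close>
  define conj where "conj x = (\<lambda>k\<in>K. x \<otimes> k \<otimes> inv x)" for x
  have "inj_on conj (carrier G)"
  proof (rule inj_onI)
    fix x y assume x: "x \<in> carrier G" and y: "y \<in> carrier G" and eq: "conj x = conj y"
    \<comment> \<open>If x and y conjugate every k in the same way, then y^-1 x centralizes
      \<open>K\<close>.\<close>
    have "inv y \<otimes> x \<otimes> k = k \<otimes> (inv y \<otimes> x)" if "k \<in> K" for k
    proof -
      have k: "k \<in> carrier G" using that K by auto
      have e: "x \<otimes> k \<otimes> inv x = y \<otimes> k \<otimes> inv y"
        using fun_cong[OF eq, of k] that by (simp add: conj_def)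
      have "x \<otimes> k = y \<otimes> k \<otimes> inv y \<otimes> x"
        using e x y k by (simp add: conj_eq_iff)
      then have "inv y \<otimes> (x \<otimes> k) = k \<otimes> (inv y \<otimes> x)"
        using x y k by (simp add: m_assoc) (simp add: m_assoc[symmetric])
      then show ?thesis
        using x y k by (simp add: m_assoc)
    qed
    then have "inv y \<otimes> x \<in> set_centralizer G K"
      using x y by (auto simp: set_centralizer_def)
    then have "inv y \<otimes> x = \<one>" using triv by auto
    then show "x = y"
      using x y by (metis inv_closed inv_equality inv_inv)
  qed
  moreover have "conj ` carrier G \<subseteq> K \<rightarrow>\<^sub>E K"
    using closed by (auto simp: conj_def)
  ultimately have "card (carrier G) \<le> card (K \<rightarrow>\<^sub>E K)"
    using K by (intro card_inj_on_le) (auto intro: finite_PiE)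
  then show ?thesis using K by (simp add: card_PiE)
qed

end

section \<open>Actions with many fixed points\<close>

context group_action
begin

text \<open>The map \<open>\<phi> x\<close> sends fixed points of g injectively to fixed points of x
  g x^-1. This one inequality is all that the lower bound in the double count uses.\<close>

lemma card_invariants_conj:
  assumes "finite E" "x \<in> carrier G" "g \<in> carrier G"
  shows "card (invariants E \<phi> g) \<le> card (invariants E \<phi> (x \<otimes> g \<otimes> inv x))"
proof (rule card_inj_on_le[where f = "\<phi> x"])
  interpret group G using group_hom group_hom.axioms(1) by auto
  show "inj_on (\<phi> x) (invariants E \<phi> g)"
    using inj_prop[OF assms(2)] by (rule inj_on_subset) (auto simp: invariants_def)
  show "\<phi> x ` invariants E \<phi> g \<subseteq> invariants E \<phi> (x \<otimes> g \<otimes> inv x)"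
  proof safe
    fix y assume y: "y \<in> invariants E \<phi> g"
    then have yE: "y \<in> E" "\<phi> g y = y" by (auto simp: invariants_def)
    have "\<phi> x y \<in> E" using element_image assms yE by blast
    moreover have "\<phi> (x \<otimes> g \<otimes> inv x) (\<phi> x y) = \<phi> (x \<otimes> g \<otimes> inv x \<otimes> x) y"
      using assms yE by (simp add: composition_rule)
    moreover have "x \<otimes> g \<otimes> inv x \<otimes> x = x \<otimes> g" using assms by (simp add: m_assoc)
    ultimately show "\<phi> x y \<in> invariants E \<phi> (x \<otimes> g \<otimes> inv x)"
      using assms yE by (simp add: invariants_def composition_rule)
  qed
  show "finite (invariants E \<phi> (x \<otimes> g \<otimes> inv x))" using assms by (simp add: invariants_def)
qed

text \<open>Double count of the pairs (k, x) with k in the class of g and k x = x: by k there are at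
  least as many points as g fixes, by x at most as many elements as the stabilizer has.\<close>

lemma conj_class_times_invariants:
  fixes b :: real
  assumes fin: "finite E" "finite (carrier G)" and g: "g \<in> carrier G"
    and stab: "\<And>x. x \<in> E \<Longrightarrow> real (card (stabilizer G \<phi> x)) \<le> b"
  shows "real (card (conj_class G g)) * real (card (invariants E \<phi> g)) \<le> real (card E) * b"
proof -
  interpret group G using group_hom group_hom.axioms(1) by auto
  let ?K = "conj_class G g"
  have K: "?K \<subseteq> carrier G" "finite ?K"
    using conj_class_subset[OF g] fin finite_subset by auto
  have "card ?K * card (invariants E \<phi> g) \<le> (\<Sum>k\<in>?K. card {x \<in> E. \<phi> k x = x})"
    using card_invariants_conj[OF fin(1) _ g]
    by (intro sum_bounded_below[where 'a = nat, simplified])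
       (auto simp: conj_class_def invariants_def)
  \<comment> \<open>Exchange of the order of summation over the incident pairs.\<close>
  also have "\<dots> = (\<Sum>x\<in>E. card {k \<in> ?K. \<phi> k x = x})"
    by (rule sum_multicount_gen) (use fin K in auto)
  finally have "real (card ?K * card (invariants E \<phi> g)) \<le> (\<Sum>x\<in>E. real (card {k \<in> ?K. \<phi> k x = x}))"
    by (simp only: of_nat_sum[symmetric] of_nat_le_iff)
  also have "\<dots> \<le> (\<Sum>x\<in>E. b)"
  proof (rule sum_mono)
    fix x assume "x \<in> E"
    have "card {k \<in> ?K. \<phi> k x = x} \<le> card (stabilizer G \<phi> x)"
      using K fin by (intro card_mono) (auto simp: stabilizer_def)
    with stab[OF \<open>x \<in> E\<close>] show "real (card {k \<in> ?K. \<phi> k x = x}) \<le> b" by linarith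
  qed
  finally show ?thesis by simp
qed

text \<open>The orbit map at a base point is a surjection from the group onto \<open>E\<close>; the
  empty set is split off because it has no base point.\<close>

lemma card_le_of_transitive:
  assumes "finite (carrier G)" and "\<And>x y. x \<in> E \<Longrightarrow> y \<in> E \<Longrightarrow> \<exists>g\<in>carrier G. \<phi> g x = y"
  shows "card E \<le> card (carrier G)"
proof (cases "E = {}")
  case False
  then obtain x where "x \<in> E" by auto
  then have "E \<subseteq> (\<lambda>g. \<phi> g x) ` carrier G" using assms(2) by blast
  then show ?thesis using assms(1) by (rule surj_card_le[rotated])
qed auto

end

text \<open>The core bound, stated for abstract faithful actions: \<open>quasi\<close> stands for
  quasiprimitivity and \<open>fixed\<close> for the bound on the minimal degree. The class of g has
  at most b / a elements, and its size is an integer, hence the floor.\<close>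

lemma (in faithful_action) card_le_of_normal_transitive:
  fixes a b :: real
  assumes fin: "finite E" "finite (carrier G)" and ab: "a > 0"
    and quasi: "\<And>N x y. N \<lhd> G \<Longrightarrow> N \<noteq> {\<one>} \<Longrightarrow> x \<in> E \<Longrightarrow> y \<in> E \<Longrightarrow> \<exists>n\<in>N. \<phi> n x = y"
    and g: "g \<in> carrier G" "g \<noteq> \<one>"
    and fixed: "a * real (card E) \<le> real (card (invariants E \<phi> g))"
    and stab: "\<And>x. x \<in> E \<Longrightarrow> real (card (stabilizer G \<phi> x)) \<le> b"
  shows "card E \<le> nat \<lfloor>b / a\<rfloor> ^ nat \<lfloor>b / a\<rfloor>"
proof (cases "E = {}")
  case False
  interpret group G using group_hom group_hom.axioms(1) by auto
  let ?K = "conj_class G g" and ?k = "nat \<lfloor>b / a\<rfloor>"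
  have K: "?K \<subseteq> carrier G" "finite ?K" "g \<in> ?K"
    using conj_class_subset[OF g(1)] conj_class_self[OF g(1)] fin by (auto intro: finite_subset)
  \<comment> \<open>Positivity allows cancelling \<open>card E\<close> from the double count
    below.\<close>
  have posE: "card E > 0" using False fin by (simp add: card_gt_0_iff)
  have "real (card ?K) * (a * real (card E)) \<le> real (card ?K) * real (card (invariants E \<phi> g))"
    using fixed by (intro mult_left_mono) auto
  also have "\<dots> \<le> real (card E) * b"
    using conj_class_times_invariants[OF fin g(1) stab] by simp
  finally have "(real (card ?K) * a) * real (card E) \<le> b * real (card E)"
    by (simp add: mult_ac)
  then have "real (card ?K) * a \<le> b" using posE by simp
  then have "real (card ?K) \<le> b / a" using ab by (simp add: pos_le_divide_eq)
  then have cK: "card ?K \<le> ?k" by linarith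
  \<comment> \<open>The class contains g. A base of at least 1 is what makes the power monotone in
    its exponent at the end.\<close>
  have cK1: "card ?K \<ge> 1" using K by (simp add: Suc_le_eq card_gt_0_iff) blast
  let ?C = "set_centralizer G ?K"
  have closed: "\<And>x k. x \<in> carrier G \<Longrightarrow> k \<in> ?K \<Longrightarrow> x \<otimes> k \<otimes> inv x \<in> ?K"
    using conj_class_closed g by blast
  have "?C = {\<one>}"
  proof (rule ccontr)
    assume ne: "?C \<noteq> {\<one>}"
    \<comment> \<open>At least a |E| > 0 points are fixed, so g has a fixed point x.\<close>
    have "real (card (invariants E \<phi> g)) > 0"
      using fixed ab posE by (smt (verit) mult_pos_pos of_nat_0_less_iff)
    then have "card (invariants E \<phi> g) > 0" by simp
    then have "invariants E \<phi> g \<noteq> {}" by fastforce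
    then obtain x where x: "x \<in> E" "\<phi> g x = x" by (auto simp: invariants_def)
    \<comment> \<open>Transitivity of the centralizer gives y = c x with c commuting with g, so g y
      = g c x = c g x = c x = y.\<close>
    have "\<phi> g y = \<phi> \<one> y" if y: "y \<in> E" for y
    proof -
      obtain c where c: "c \<in> ?C" "\<phi> c x = y"
        using quasi[OF set_centralizer_normal[OF K(1) closed] ne x(1) y] by blast
      have cG: "c \<in> carrier G" and comm: "c \<otimes> g = g \<otimes> c"
        using c K(3) by (auto simp: set_centralizer_def)
      have "\<phi> g y = \<phi> (g \<otimes> c) x" using c cG g x by (simp add: composition_rule)
      also have "\<dots> = \<phi> (c \<otimes> g) x" by (simp only: comm)
      also have "\<dots> = y" using c cG g x by (simp add: composition_rule)
      finally show ?thesis using y by (simp flip: id_eq_one)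
    qed
    \<comment> \<open>Both maps are extensional, so agreement on \<open>E\<close> is equality of
      functions, and faithfulness then forces g to be the identity.\<close>
    moreover have "\<phi> g \<in> extensional E" "\<phi> \<one> \<in> extensional E"
      using bij_prop0 g(1) by (auto simp: Bij_def)
    ultimately have "\<phi> g = \<phi> \<one>" by (meson extensionalityI)
    then show False using faithful g by (auto dest: inj_onD)
  qed
  then have cG: "card (carrier G) \<le> card ?K ^ card ?K"
    using card_le_of_trivial_centralizer K closed by blast
  \<comment> \<open>The whole group is itself a nontrivial normal subgroup, hence
    transitive.\<close>
  have "carrier G \<lhd> G" by (auto simp: normal_inv_iff subgroup_self)
  moreover have "carrier G \<noteq> {\<one>}" using g by auto
  ultimately have "card E \<le> card (carrier G)"
    using fin quasi by (intro card_le_of_transitive) blast+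
  also note cG
  also have "card ?K ^ card ?K \<le> card ?K ^ ?k" using cK cK1 by (rule power_increasing)
  also have "\<dots> \<le> ?k ^ ?k" using cK by (intro power_mono) auto
  finally show ?thesis .
qed simp

section \<open>Permutation groups\<close>

lemma perm_group_simps [simp]:
  "carrier (perm_group \<Omega> G) = G"
  "\<one>\<^bsub>perm_group \<Omega> G\<^esub> = (\<lambda>x\<in>\<Omega>. x)"
  "mult (perm_group \<Omega> G) = (\<lambda>g \<in> Bij \<Omega>. \<lambda>f \<in> Bij \<Omega>. compose \<Omega> g f)"
  by (simp_all add: perm_group_def BijGroup_def)

text \<open>The natural action is the inclusion of \<open>G\<close> into
  \<open>BijGroup \<Omega>\<close>, an injective homomorphism. This makes the results on abstract
  actions available for permutation groups.\<close>

lemma faithful_action_perm_group: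
  assumes "subgroup G (BijGroup \<Omega>)"
  shows "faithful_action (perm_group \<Omega> G) \<Omega> (\<lambda>g. g)"
proof -
  interpret B: group "BijGroup \<Omega>" by (rule group_BijGroup)
  have "group (perm_group \<Omega> G)"
    unfolding perm_group_def by (rule B.subgroup_imp_group[OF assms])
  then have "group_hom (perm_group \<Omega> G) (BijGroup \<Omega>) (\<lambda>g. g)"
    using subgroup.subset[OF assms]
    by (auto simp: group_hom_def group_hom_axioms_def hom_def B.group_axioms perm_group_def)
  then show ?thesis
    by (simp add: faithful_action_def faithful_action_axioms_def group_action_def)
qed

lemma finite_Bij:
  assumes "finite \<Omega>"
  shows "finite (Bij \<Omega>)"
proof (rule finite_subset)
  show "Bij \<Omega> \<subseteq> \<Omega> \<rightarrow>\<^sub>E \<Omega>"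
    by (auto simp: Bij_def PiE_def dest: bij_betw_imp_funcset)
  show "finite (\<Omega> \<rightarrow>\<^sub>E \<Omega>)"
    using assms by (intro finite_PiE)
qed

text \<open>An element attaining the minimal degree moves at most (1 - a) |\<Omega>| points and so
  fixes at least a |\<Omega>|; it serves as g in the abstract bound.\<close>

lemma quasiprimitive_card_le:
  fixes a b :: real
  assumes fin: "finite \<Omega>" and quasi: "quasiprimitive \<Omega> G" and "a > 0"
    and ne: "G \<noteq> {\<one>\<^bsub>BijGroup \<Omega>\<^esub>}"
    and deg: "real (min_degree \<Omega> G) \<le> (1 - a) * real (card \<Omega>)"
    and stab: "\<And>x. x \<in> \<Omega> \<Longrightarrow> real (card (stabilizer (perm_group \<Omega> G) (\<lambda>g. g) x)) \<le> b"
  shows "card \<Omega> \<le> nat \<lfloor>b / a\<rfloor> ^ nat \<lfloor>b / a\<rfloor>"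
proof -
  have sub: "subgroup G (BijGroup \<Omega>)" using quasi by (simp add: quasiprimitive_def)
  interpret faithful_action "perm_group \<Omega> G" \<Omega> "\<lambda>g. g"
    by (rule faithful_action_perm_group[OF sub])
  have finG: "finite G"
    using subgroup.subset[OF sub] finite_Bij[OF fin] by (auto simp: BijGroup_def finite_subset)
  let ?D = "(\<lambda>g. card (supp \<Omega> g)) ` (G - {\<one>\<^bsub>BijGroup \<Omega>\<^esub>})"
  \<comment> \<open>Nontriviality of \<open>G\<close> makes the set under \<open>Min\<close>
    nonempty, so the minimum is attained.\<close>
  have "G - {\<one>\<^bsub>BijGroup \<Omega>\<^esub>} \<noteq> {}"
    using ne subgroup.one_closed[OF sub] by auto
  then have "min_degree \<Omega> G \<in> ?D"
    unfolding min_degree_def using finG by (intro Min_in) auto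
  then obtain g where g: "g \<in> G" "g \<noteq> (\<lambda>x\<in>\<Omega>. x)" "card (supp \<Omega> g) = min_degree \<Omega> G"
    by (force simp: BijGroup_def)
  have "invariants \<Omega> (\<lambda>g. g) g = \<Omega> - supp \<Omega> g" "supp \<Omega> g \<subseteq> \<Omega>"
    by (auto simp: invariants_def supp_def)
  then have "real (card (invariants \<Omega> (\<lambda>g. g) g)) = real (card \<Omega>) - real (min_degree \<Omega> G)"
    using fin g(3) by (metis card_Diff_subset card_mono finite_subset of_nat_diff)
  then have fixed: "a * real (card \<Omega>) \<le> real (card (invariants \<Omega> (\<lambda>g. g) g))"
    using deg by (simp add: algebra_simps)
  have tr: "\<exists>n\<in>N. n x = y"
    if "N \<lhd> perm_group \<Omega> G" "N \<noteq> {\<one>\<^bsub>perm_group \<Omega> G\<^esub>}" "x \<in> \<Omega>" "y \<in> \<Omega>" for N x y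
  proof -
    have "transitive_action (perm_group \<Omega> N) \<Omega> (\<lambda>g. g)"
      using quasi that by (auto simp: quasiprimitive_def BijGroup_def)
    from transitive_action.unique_orbit[OF this that(3,4)] show ?thesis by simp
  qed
  show ?thesis
    by (rule card_le_of_normal_transitive[OF fin _ \<open>a > 0\<close> tr _ _ fixed stab])
       (use g finG in simp_all)
qed

section \<open>Transport of permutation groups along bijections\<close>

definition conj_map :: "('a \<Rightarrow> 'b) \<Rightarrow> 'a set \<Rightarrow> 'b set \<Rightarrow> ('a \<Rightarrow> 'a) \<Rightarrow> 'b \<Rightarrow> 'b" where
  "conj_map f \<Omega> \<Omega>' g = (\<lambda>y\<in>\<Omega>'. f (g (inv_into \<Omega> f y)))"

lemma conj_map_apply:
  "bij_betw f \<Omega> \<Omega>' \<Longrightarrow> x \<in> \<Omega> \<Longrightarrow> conj_map f \<Omega> \<Omega>' g (f x) = f (g x)"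
  by (auto simp: conj_map_def bij_betw_def inv_into_f_f)

text \<open>On \<Omega>' the map is f g f^-1; the restriction built into \<open>conj_map\<close>
  supplies the extensionality that \<open>Bij\<close> demands.\<close>

lemma conj_map_Bij:
  assumes f: "bij_betw f \<Omega> \<Omega>'" and g: "g \<in> Bij \<Omega>"
  shows "conj_map f \<Omega> \<Omega>' g \<in> Bij \<Omega>'"
proof -
  have "bij_betw (f \<circ> g \<circ> inv_into \<Omega> f) \<Omega>' \<Omega>'"
    using f g bij_betw_inv_into[OF f] by (auto simp: Bij_def intro: bij_betw_trans)
  then have "bij_betw (conj_map f \<Omega> \<Omega>' g) \<Omega>' \<Omega>'"
    by (rule bij_betw_cong[THEN iffD1, rotated]) (simp add: conj_map_def)
  then show ?thesis by (simp add: Bij_def conj_map_def)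
qed

lemma inj_on_conj_map:
  assumes f: "bij_betw f \<Omega> \<Omega>'"
  shows "inj_on (conj_map f \<Omega> \<Omega>') (Bij \<Omega>)"
proof (rule inj_onI)
  fix g h assume gh: "g \<in> Bij \<Omega>" "h \<in> Bij \<Omega>" and eq: "conj_map f \<Omega> \<Omega>' g = conj_map f \<Omega> \<Omega>' h"
  show "g = h"
  proof (rule extensionalityI[of _ \<Omega>])
    fix x assume x: "x \<in> \<Omega>"
    have "f (g x) = f (h x)"
      using conj_map_apply[OF f x, of g] conj_map_apply[OF f x, of h] eq by simp
    moreover have "g x \<in> \<Omega>" "h x \<in> \<Omega>" using gh x by (auto dest!: Bij_imp_funcset)
    ultimately show "g x = h x" using f by (auto simp: bij_betw_def dest: inj_onD)
  qed (use gh in \<open>auto simp: Bij_def\<close>)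
qed

text \<open>The bijection f on points and conjugation by f on group elements form the required
  pair.\<close>

lemma perm_isomorphic_conj:
  assumes f: "bij_betw f \<Omega> \<Omega>'" and G: "G \<subseteq> Bij \<Omega>"
  shows "perm_isomorphic (\<Omega>, G) (\<Omega>', conj_map f \<Omega> \<Omega>' ` G)"
proof -
  let ?c = "conj_map f \<Omega> \<Omega>'"
  have "?c (compose \<Omega> g h) = compose \<Omega>' (?c g) (?c h)" if "g \<in> Bij \<Omega>" "h \<in> Bij \<Omega>" for g h
  proof (rule extensionalityI[of _ \<Omega>'])
    fix y assume "y \<in> \<Omega>'"
    then obtain x where x: "x \<in> \<Omega>" "y = f x" using f by (auto simp: bij_betw_def)
    have "h x \<in> \<Omega>" using that x by (auto dest!: Bij_imp_funcset)
    then show "?c (compose \<Omega> g h) y = compose \<Omega>' (?c g) (?c h) y"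
      using x \<open>y \<in> \<Omega>'\<close> by (simp add: compose_eq conj_map_apply[OF f])
  qed (auto simp: conj_map_def)
  then have "?c \<in> hom (perm_group \<Omega> G) (perm_group \<Omega>' (?c ` G))"
    using G conj_map_Bij[OF f] by (auto simp: hom_def subset_iff)
  moreover have "inj_on ?c G" using inj_on_conj_map[OF f] G by (rule inj_on_subset)
  ultimately have "?c \<in> iso (perm_group \<Omega> G) (perm_group \<Omega>' (?c ` G))"
    by (simp add: iso_def bij_betw_def)
  then show ?thesis
    using f conj_map_apply[OF f] unfolding perm_isomorphic_def by fastforce
qed

text \<open>Two groups with the same relabelled copy on \<open>A\<close> are matched by relabelling
  with e and then undoing e'.\<close>

lemma perm_isomorphic_of_common_conj:
  assumes e: "bij_betw e \<Omega> A" and e': "bij_betw e' \<Omega>' A"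
    and G: "G \<subseteq> Bij \<Omega>" and G': "G' \<subseteq> Bij \<Omega>'"
    and eq: "conj_map e \<Omega> A ` G = conj_map e' \<Omega>' A ` G'"
  shows "perm_isomorphic (\<Omega>, G) (\<Omega>', G')"
proof -
  define f where "f = inv_into \<Omega>' e' \<circ> e"
  have f: "bij_betw f \<Omega> \<Omega>'"
    unfolding f_def using e bij_betw_inv_into[OF e'] by (rule bij_betw_trans)
  have e'f: "e' (f x) = e x" if "x \<in> \<Omega>" for x
    using that e e' by (auto simp: f_def bij_betw_def f_inv_into_f)
  have factor: "conj_map e' \<Omega>' A (conj_map f \<Omega> \<Omega>' g) = conj_map e \<Omega> A g" if "g \<in> Bij \<Omega>" for g
  proof (rule extensionalityI[of _ A])
    fix y assume "y \<in> A"
    then obtain x where x: "x \<in> \<Omega>" "y = e x" using e by (auto simp: bij_betw_def)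
    have "f x \<in> \<Omega>'" "g x \<in> \<Omega>"
      using f x that by (auto simp: bij_betw_def dest!: Bij_imp_funcset)
    then have "conj_map e' \<Omega>' A (conj_map f \<Omega> \<Omega>' g) (e' (f x)) = e' (f (g x))"
      using x by (simp add: conj_map_apply[OF e'] conj_map_apply[OF f])
    then show "conj_map e' \<Omega>' A (conj_map f \<Omega> \<Omega>' g) y = conj_map e \<Omega> A g y"
      using x \<open>g x \<in> \<Omega>\<close> by (simp add: e'f conj_map_apply[OF e])
  qed (auto simp: conj_map_def)
  have "conj_map e' \<Omega>' A ` conj_map f \<Omega> \<Omega>' ` G = conj_map e \<Omega> A ` G"
    unfolding image_image using factor G by (intro image_cong) auto
  \<comment> \<open>Both groups have the same image under conjugation by e', which is injective on
    \<open>Bij \<Omega>'\<close>.\<close>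
  then have "conj_map f \<Omega> \<Omega>' ` G = G'"
    using inj_on_image_eq_iff[OF inj_on_conj_map[OF e'], of "conj_map f \<Omega> \<Omega>' ` G" G']
      conj_map_Bij[OF f] G G' eq by auto
  then show ?thesis using perm_isomorphic_conj[OF f G] by simp
qed

section \<open>Finitely many isomorphism types of bounded degree\<close>

lemma finite_representatives:
  assumes "finite (c ` F)" and "\<And>X Y. X \<in> F \<Longrightarrow> Y \<in> F \<Longrightarrow> c X = c Y \<Longrightarrow> P X Y"
  shows "\<exists>R. finite R \<and> R \<subseteq> F \<and> (\<forall>X\<in>F. \<exists>Y\<in>R. P X Y)"
proof (intro exI conjI ballI)
  \<comment> \<open>One preimage is chosen for each value of c.\<close>
  show "finite (inv_into F c ` c ` F)" "inv_into F c ` c ` F \<subseteq> F"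
    using assms(1) by (auto intro: inv_into_into)
  fix X assume "X \<in> F"
  then show "\<exists>Y\<in>inv_into F c ` c ` F. P X Y"
    by (intro bexI[of _ "inv_into F c (c X)"] assms(2)) (auto simp: inv_into_into f_inv_into_f)
qed

text \<open>Numbering the points turns each group into a set of permutations of {0..<m} with m at
  most M, and there are finitely many such sets.\<close>

lemma finite_perm_isomorphism_types:
  fixes \<F> :: "('a set \<times> ('a \<Rightarrow> 'a) set) set"
  assumes "\<And>\<Omega> G. (\<Omega>, G) \<in> \<F> \<Longrightarrow> finite \<Omega> \<and> card \<Omega> \<le> M \<and> G \<subseteq> Bij \<Omega>"
  shows "\<exists>\<R>. finite \<R> \<and> \<R> \<subseteq> \<F> \<and> (\<forall>X\<in>\<F>. \<exists>Y\<in>\<R>. perm_isomorphic X Y)"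
proof -
  define e :: "'a set \<Rightarrow> 'a \<Rightarrow> nat" where "e \<Omega> = (SOME h. bij_betw h \<Omega> {0..<card \<Omega>})" for \<Omega>
  have e: "bij_betw (e \<Omega>) \<Omega> {0..<card \<Omega>}" if "finite \<Omega>" for \<Omega>
    unfolding e_def using ex_bij_betw_finite_nat[OF that] by (rule someI_ex)
  \<comment> \<open>The numbering \<open>e\<close> is an arbitrary choice, so isomorphic groups may
    receive different codes. It is enough that equal codes imply isomorphism; the recorded degree
    ensures a common target set.\<close>
  define c where "c = (\<lambda>(\<Omega>, G). (card \<Omega>, conj_map (e \<Omega>) \<Omega> {0..<card \<Omega>} ` G))"
  have "c ` \<F> \<subseteq> (SIGMA m:{..M}. Pow (Bij {0..<m}))"
  proof (rule image_subsetI)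
    fix X assume "X \<in> \<F>"
    moreover obtain \<Omega> G where "X = (\<Omega>, G)" by fastforce
    ultimately have X: "X = (\<Omega>, G)" "finite \<Omega>" "card \<Omega> \<le> M" "G \<subseteq> Bij \<Omega>"
      using assms by auto
    then show "c X \<in> (SIGMA m:{..M}. Pow (Bij {0..<m}))"
      using conj_map_Bij[OF e[OF X(2)]] by (auto simp: c_def)
  qed
  moreover have "finite (SIGMA m:{..M}. Pow (Bij {0..<m}))"
    by (auto intro: finite_Bij)
  ultimately have "finite (c ` \<F>)" by (rule finite_subset)
  then show ?thesis
  proof (rule finite_representatives)
    fix X Y assume "X \<in> \<F>" "Y \<in> \<F>" and cXY: "c X = c Y"
    obtain \<Omega> G \<Omega>' G' where XY: "X = (\<Omega>, G)" "Y = (\<Omega>', G')" by fastforce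
    have card: "card \<Omega> = card \<Omega>'"
      and eq: "conj_map (e \<Omega>) \<Omega> {0..<card \<Omega>} ` G = conj_map (e \<Omega>') \<Omega>' {0..<card \<Omega>} ` G'"
      using cXY by (auto simp: c_def XY)
    show "perm_isomorphic X Y"
      unfolding XY using assms \<open>X \<in> \<F>\<close> \<open>Y \<in> \<F>\<close> e[of \<Omega>] e[of \<Omega>'] eq card
      by (intro perm_isomorphic_of_common_conj[where A = "{0..<card \<Omega>}"]) (auto simp: XY)
  qed
qed

text \<open>Finiteness up to isomorphism is expressed by a finite set of representatives inside the
  family. Trivial groups are excluded because their minimal degree would be a minimum over the empty
  set.\<close>

theorem theorem12:
  fixes \<alpha> \<beta> :: real
    and \<F> :: "('a set \<times> ('a \<Rightarrow> 'a) set) set"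
  assumes "\<alpha> > 0" and "\<beta> > 0"
    and "\<And>\<Omega> G. (\<Omega>, G) \<in> \<F> \<Longrightarrow> finite \<Omega> \<and> quasiprimitive \<Omega> G"
    and "\<And>\<Omega> G. (\<Omega>, G) \<in> \<F> \<Longrightarrow> G \<noteq> {\<one>\<^bsub>BijGroup \<Omega>\<^esub>}"
    and "\<And>\<Omega> G. (\<Omega>, G) \<in> \<F> \<Longrightarrow> real (min_degree \<Omega> G) \<le> (1 - \<alpha>) * real (card \<Omega>)"
    and "\<And>\<Omega> G \<omega>. (\<Omega>, G) \<in> \<F> \<Longrightarrow> \<omega> \<in> \<Omega> \<Longrightarrow>
           real (card (stabilizer (perm_group \<Omega> G) (\<lambda>g. g) \<omega>)) \<le> \<beta>"
  shows "\<exists>\<R>. finite \<R> \<and> \<R> \<subseteq> \<F> \<and> (\<forall>X\<in>\<F>. \<exists>Y\<in>\<R>. perm_isomorphic X Y)"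
proof (rule finite_perm_isomorphism_types)
  fix \<Omega> G assume mem: "(\<Omega>, G) \<in> \<F>"
  have fin: "finite \<Omega>" and quasi: "quasiprimitive \<Omega> G" using assms(3)[OF mem] by auto
  \<comment> \<open>The bound depends on \<alpha> and \<beta> only, so it is uniform over the
    family.\<close>
  have "card \<Omega> \<le> nat \<lfloor>\<beta> / \<alpha>\<rfloor> ^ nat \<lfloor>\<beta> / \<alpha>\<rfloor>"
    by (rule quasiprimitive_card_le[OF fin quasi assms(1) assms(4)[OF mem] assms(5)[OF mem]
          assms(6)[OF mem]])
  moreover have "G \<subseteq> Bij \<Omega>"
    using quasi subgroup.subset[of G "BijGroup \<Omega>"]
    by (simp add: quasiprimitive_def) (simp add: BijGroup_def)
  ultimately show "finite \<Omega> \<and> card \<Omega> \<le> nat \<lfloor>\<beta> / \<alpha>\<rfloor> ^ nat \<lfloor>\<beta> / \<alpha>\<rfloor> \<and> G \<subseteq> Bij \<Omega>"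
    using fin by blast
qed

end
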